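(* Let $f\in C(I,I)$ be null. Then for every finite open cover $\mathcal U$ of $I$, $p^*_{I,\mathcal U}(n)$ is of polynomial order: there exist constants $C>0$ and $q\in\mathbb N$ (depending only on $\mathcal U$) such that $p^*_{I,\mathcal U}(n)\le C\,n^q$ for all $n\ge1$.
   Context: $I=[0,1]$, $C(I,I)$ continuous self-maps of $I$. For a finite open cover $\mathcal U$, $N(\mathcal U)$ is the minimal cardinality of a subcover and $\bigvee$ denotes common refinement. For $A=\{t_1<t_2<\cdots\}\subset\mathbb Z_+$, $h_A(f,\mathcal U)=\limsup_{n\to\infty}\frac1n\log N(\bigvee_{i=1}^nf^{-t_i}\mathcal U)$ and $h_A(f)=\sup_{\mathcal U}h_A(f,\mathcal U)$; $f$ is null if $\sup_Ah_A(f)=0$. The maximal pattern complexity is $p^*_{I,\mathcal U}(n)=\max_{0\le t_1<\cdots<t_n}N\big(\bigvee_{i=1}^nf^{-t_i}\mathcal U\big)$. *)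

theory Defs
  imports "HOL-Analysis.Analysis"
begin

definition II :: "real set" where "II = {0..1}"

definition self_map_I :: "(real \<Rightarrow> real) \<Rightarrow> bool" where
  "self_map_I f \<longleftrightarrow> continuous_on II f \<and> f ` II \<subseteq> II"

definition open_cover :: "real set set \<Rightarrow> bool" where
  "open_cover \<U> \<longleftrightarrow> finite \<U> \<and> (\<forall>U\<in>\<U>. openin (top_of_set II) U) \<and> II \<subseteq> \<Union>\<U>"

definition Ncov :: "real set set \<Rightarrow> nat" where
  "Ncov \<U> = (LEAST k. \<exists>\<V>\<subseteq>\<U>. finite \<V> \<and> card \<V> = k \<and> II \<subseteq> \<Union>\<V>)"

definition pre_cover :: "(real \<Rightarrow> real) \<Rightarrow> nat \<Rightarrow> real set set \<Rightarrow> real set set" where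
  "pre_cover f t \<U> = {(f ^^ t) -` U \<inter> II | U. U \<in> \<U>}"

definition join_cover :: "(real \<Rightarrow> real) \<Rightarrow> (nat \<Rightarrow> nat) \<Rightarrow> nat \<Rightarrow> real set set \<Rightarrow> real set set" where
  "join_cover f t n \<U> =
     {II \<inter> (\<Inter>i\<in>{..<n}. g i) | g. \<forall>i<n. g i \<in> pre_cover f (t i) \<U>}"

text \<open>h_A(f,U) for A = range of the strictly increasing sequence t\<close>
definition seq_entropy_cover :: "(real \<Rightarrow> real) \<Rightarrow> (nat \<Rightarrow> nat) \<Rightarrow> real set set \<Rightarrow> ereal" where
  "seq_entropy_cover f t \<U> =
     limsup (\<lambda>n. ereal (ln (real (Ncov (join_cover f t n \<U>))) / real n))"

definition seq_entropy :: "(real \<Rightarrow> real) \<Rightarrow> (nat \<Rightarrow> nat) \<Rightarrow> ereal" where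
  "seq_entropy f t = (SUP \<U>\<in>{\<U>. open_cover \<U>}. seq_entropy_cover f t \<U>)"

definition null_map :: "(real \<Rightarrow> real) \<Rightarrow> bool" where
  "null_map f \<longleftrightarrow> (SUP t\<in>{t. strict_mono t}. seq_entropy f t) = 0"

definition pstar :: "(real \<Rightarrow> real) \<Rightarrow> real set set \<Rightarrow> nat \<Rightarrow> nat" where
  "pstar f \<U> n = Sup {Ncov (join_cover f t n \<U>) | t. strict_mono_on {..<n} t}"

end

theory Submission
  imports Defs
begin

text \<open>
  Nullness bounds the size of the independence sets of any two disjoint closed sets, since arbitrarily
  large ones could be concatenated into a sequence of positive entropy. Hence, for \<open>c < d\<close>, a
  Sauer--Shelah count bounds polynomially the itineraries relative to \<open>{..c}\<close> and \<open>{d..}\<close>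
  as long as the visits to the gap \<open>{c<..<d}\<close> are under control. Every interval contains such a gap:
  either some subinterval is visited a bounded number of times by every orbit, or periodic points are
  dense, because the visits of an orbit to an interval without periodic points are monotone. In the
  latter case some iterate is the identity on a subinterval, as otherwise there is a horseshoe,
  contradicting nullness. Finitely many gaps separate points at any prescribed distance, so that
  itineraries relative to them refine the given cover at all times.
\<close>

section \<open>Iterates of a self-map of the interval\<close>

lemma funpow_in_II:
  assumes "self_map_I f" "x \<in> II" shows "(f ^^ t) x \<in> II"
  using assms by (induction t) (auto simp: self_map_I_def)

lemma continuous_on_funpow:
  assumes "self_map_I f" shows "continuous_on II (f ^^ t)"
proof (induction t)
  case (Suc t)
  have "continuous_on ((f ^^ t) ` II) f"
    using assms funpow_in_II[OF assms] by (auto simp: self_map_I_def intro: continuous_on_subset)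
  then show ?case
    using Suc continuous_on_compose[of II "f ^^ t" f] by simp
qed (auto simp: id_def intro: continuous_intros)

lemma self_map_I_funpow:
  assumes "self_map_I f" shows "self_map_I (f ^^ t)"
  using continuous_on_funpow[OF assms] funpow_in_II[OF assms] by (auto simp: self_map_I_def)

lemma funpow_add_apply: "(f ^^ (m + n)) x = (f ^^ m) ((f ^^ n) x)"
  by (simp add: funpow_add)

lemma funpow_fixed:
  assumes "(f ^^ n) x = x" shows "(f ^^ (k * n)) x = x"
  using assms by (induction k) (simp_all add: funpow_add)

section \<open>Intervals without periodic points\<close>

text \<open>By the intermediate value theorem \<open>h z - z\<close> cannot change sign on
  \<open>J\<close> without vanishing there. The factor \<open>s\<close> treats motion to the right
  (\<open>s > 0\<close>) and to the left (\<open>s < 0\<close>) at once.\<close>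

lemma no_fixed_point_same_side:
  fixes s :: real
  assumes h: "continuous_on II h" and J: "is_interval J" "J \<subseteq> II"
    and nofix: "\<And>x. x \<in> J \<Longrightarrow> h x \<noteq> x"
    and x: "x \<in> J" "0 < s * (h x - x)" and y: "y \<in> J"
  shows "0 < s * (h y - y)"
proof (rule ccontr)
  assume neg: "\<not> 0 < s * (h y - y)"
  let ?k = "\<lambda>z. s * (h z - z)"
  have "connected (?k ` J)"
    using J h by (intro connected_continuous_image continuous_intros)
      (auto intro: continuous_on_subset simp: is_interval_connected)
  then have "0 \<in> ?k ` J"
    using neg x y connectedD_interval[of "?k ` J" "?k y" "?k x" 0] by auto
  then show False using nofix x(2) by auto
qed

text \<open>A single return of \<open>x\<close> to \<open>J\<close> fixes a direction for all of
  \<open>J\<close>. In the induction, \<open>f ^^ (k * m)\<close> moves the point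
  \<open>(f ^^ m) x\<close> of \<open>J\<close> further in the direction of the first move, so
  \<open>f ^^ (Suc k * m)\<close> moves \<open>x\<close> that way, and with it every point of
  \<open>J\<close>. Intermediate iterates may leave \<open>J\<close>.\<close>

lemma no_periodic_point_same_side:
  fixes s :: real
  assumes f: "self_map_I f" and J: "is_interval J" "J \<subseteq> II"
    and noper: "\<And>x n. x \<in> J \<Longrightarrow> n \<ge> 1 \<Longrightarrow> (f ^^ n) x \<noteq> x"
    and x: "x \<in> J" "(f ^^ m) x \<in> J" "0 < s * ((f ^^ m) x - x)" and m: "m \<ge> 1"
  shows "k \<ge> 1 \<Longrightarrow> y \<in> J \<Longrightarrow> 0 < s * ((f ^^ (k * m)) y - y)"
proof (induction k arbitrary: y rule: nat_induct_at_least)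
  case base
  then show ?case
    using no_fixed_point_same_side[OF continuous_on_funpow[OF f] J, of m x s y] noper m x by simp
next
  case (Suc k)
  have "0 < s * ((f ^^ (k * m)) ((f ^^ m) x) - (f ^^ m) x)" using Suc x by blast
  then have "0 < s * ((f ^^ (Suc k * m)) x - x)"
    using x(3) by (simp add: funpow_add_apply[of "k*m" m f x, symmetric] add.commute algebra_simps)
  moreover have "1 \<le> Suc k * m" using m by simp
  ultimately show ?case
    using no_fixed_point_same_side[OF continuous_on_funpow[OF f] J, of "Suc k * m" x s y]
      noper x(1) Suc.prems by blast
qed

text \<open>If the orbit turned back, \<open>f ^^ m\<close> would move a point of \<open>J\<close>
  in the direction of \<open>s\<close> and \<open>f ^^ (n - m)\<close> another one against it. Their
  common iterate \<open>f ^^ (m * (n - m))\<close> would then move \<open>J\<close> both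
  ways.\<close>

lemma visits_monotone:
  fixes s :: real
  assumes f: "self_map_I f" and J: "is_interval J" "J \<subseteq> II"
    and noper: "\<And>x n. x \<in> J \<Longrightarrow> n \<ge> 1 \<Longrightarrow> (f ^^ n) x \<noteq> x"
    and x: "x \<in> J" "(f ^^ m) x \<in> J" "(f ^^ n) x \<in> J" and m: "1 \<le> m" "m < n"
    and less: "0 < s * ((f ^^ m) x - x)"
  shows "0 \<le> s * ((f ^^ n) x - (f ^^ m) x)"
proof (rule ccontr)
  assume neg: "\<not> 0 \<le> s * ((f ^^ n) x - (f ^^ m) x)"
  let ?y = "(f ^^ m) x"
  have y: "(f ^^ (n - m)) ?y = (f ^^ n) x" using m by (simp flip: funpow_add_apply)
  have "0 < s * ((f ^^ ((n - m) * m)) x - x)"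
    using no_periodic_point_same_side[OF f J noper x(1,2) less m(1), of "n - m" x] x m by simp
  moreover have "0 < - s * ((f ^^ (m * (n - m))) x - x)"
    using no_periodic_point_same_side[OF f J noper x(2), of "n - m" "- s" m x] x m y neg by simp
  ultimately show False by (simp add: mult.commute[of m])
qed

text \<open>Frequent visits to every small interval yield a point that starts near \<open>w\<close>,
  jumps with \<open>w\<close> under \<open>f ^^ m\<close>, and later comes back near
  \<open>w\<close>. Without periodic points this contradicts the monotonicity of visits.\<close>

lemma dense_periodic_points:
  assumes f: "self_map_I f" and ab: "0 \<le> a" "b \<le> 1"
    and ret: "\<And>c d K. a \<le> c \<Longrightarrow> c < d \<Longrightarrow> d \<le> b \<Longrightarrow>
       \<exists>x\<in>II. \<exists>S. finite S \<and> (\<forall>t\<in>S. (f ^^ t) x \<in> {c<..<d}) \<and> card S > K"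
    and cd: "a \<le> c" "c < d" "d \<le> b"
  shows "\<exists>p\<in>{c<..<d}. \<exists>n\<ge>1. (f ^^ n) p = p"
proof (rule ccontr)
  assume "\<not> ?thesis"
  then have noper: "\<And>x n. x \<in> {c<..<d} \<Longrightarrow> n \<ge> 1 \<Longrightarrow> (f ^^ n) x \<noteq> x" by blast
  have J: "is_interval {c<..<d}" "{c<..<d} \<subseteq> II"
    using ab cd by (auto simp: II_def is_interval_oo)
  \<comment> \<open>With more than \<open>Suc K\<close> visits, the first and the last are more than
    \<open>K\<close> steps apart; \<open>w\<close> is the orbit point at the first visit.\<close>
  have two: "\<exists>w\<in>{c'<..<d'}. \<exists>n>K. (f ^^ n) w \<in> {c'<..<d'}"
    if c': "a \<le> c'" "c' < d'" "d' \<le> b" for c' d' K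
  proof -
    obtain x S where S: "x \<in> II" "finite S" "\<forall>t\<in>S. (f ^^ t) x \<in> {c'<..<d'}" "card S > Suc K"
      using ret[OF c'] by blast
    have ne: "S \<noteq> {}" using S(4) by auto
    have "S \<subseteq> {Min S..Max S}" using S(2) by auto
    then have "card S \<le> Suc (Max S) - Min S" using card_mono[of "{Min S..Max S}" S] by simp
    then have "Max S - Min S > K" using S(4) by linarith
    moreover have "(f ^^ (Max S - Min S)) ((f ^^ Min S) x) = (f ^^ Max S) x"
      using ne S(2) by (simp flip: funpow_add_apply)
    ultimately show ?thesis using S ne by (metis Max_in Min_in)
  qed
  obtain w m where w: "w \<in> {c<..<d}" "m \<ge> 1" "(f ^^ m) w \<in> {c<..<d}"
    using two[OF cd, of 0] by (auto simp: Suc_le_eq)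
  \<comment> \<open>Half the length of the jump of \<open>w\<close>: if \<open>z\<close> and
    \<open>(f ^^ n) z\<close> are within \<eta> of \<open>w\<close>, and \<open>(f ^^ m) z\<close>
    is within \<eta> of \<open>(f ^^ m) w\<close>, then \<open>(f ^^ m) z\<close> lies strictly
    beyond both in the direction \<open>s\<close>.\<close>
  define \<eta> where "\<eta> = \<bar>(f ^^ m) w - w\<bar> / 2"
  define s where "s = sgn ((f ^^ m) w - w)"
  have neq: "(f ^^ m) w \<noteq> w" using noper w by blast
  have \<eta>: "\<eta> > 0" using neq by (simp add: \<eta>_def)
  have "continuous_on {c<..<d} (f ^^ m)"
    using continuous_on_funpow[OF f] J(2) continuous_on_subset by blast
  then have "isCont (f ^^ m) w" using w(1) by (simp add: continuous_on_eq_continuous_at)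
  moreover have "0 < min \<eta> (min ((f ^^ m) w - c) (d - (f ^^ m) w))" using \<eta> w by simp
  ultimately obtain e where e: "e > 0"
    "\<And>z. dist z w < e \<Longrightarrow> dist ((f ^^ m) z) ((f ^^ m) w) < min \<eta> (min ((f ^^ m) w - c) (d - (f ^^ m) w))"
    unfolding continuous_at_eps_delta by blast
  define e' where "e' = min e (min \<eta> (min (w - c) (d - w)))"
  have e': "e' > 0" "e' \<le> e" "e' \<le> \<eta>" "e' \<le> w - c" "e' \<le> d - w"
    using e(1) \<eta> w(1) by (auto simp: e'_def)
  obtain z n where z: "z \<in> {w - e'<..<w + e'}" "n > m" "(f ^^ n) z \<in> {w - e'<..<w + e'}"
    using two[of "w - e'" "w + e'" m] e' cd by auto
  have fz: "dist ((f ^^ m) z) ((f ^^ m) w) < min \<eta> (min ((f ^^ m) w - c) (d - (f ^^ m) w))"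
    using e(2)[of z] z(1) e' by (auto simp: dist_real_def)
  have inJ: "z \<in> {c<..<d}" "(f ^^ m) z \<in> {c<..<d}" "(f ^^ n) z \<in> {c<..<d}"
    using z e' fz by (auto simp: dist_real_def)
  have "0 < s * ((f ^^ m) z - z)" "s * ((f ^^ n) z - (f ^^ m) z) < 0"
    using z e' fz neq unfolding s_def \<eta>_def
    by (cases "(f ^^ m) w > w"; simp add: dist_real_def sgn_if; argo)+
  then show False
    using visits_monotone[OF f J noper inJ w(2) z(2), of s] by simp
qed

section \<open>Horseshoes\<close>

text \<open>The two branches may use different iterates \<open>p\<close> and \<open>r\<close>, since
  those found below come from different parts of a periodic orbit. As \<open>A\<close> and
  \<open>B\<close> lie inside \<open>T\<close>, coverings can be iterated.\<close>

definition horseshoe :: "(real \<Rightarrow> real) \<Rightarrow> bool" where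
  "horseshoe g \<longleftrightarrow> (\<exists>A B T p r. closed A \<and> closed B \<and> A \<inter> B = {} \<and> A \<subseteq> T \<and> B \<subseteq> T \<and> T \<subseteq> II
     \<and> T \<noteq> {} \<and> p \<ge> 1 \<and> r \<ge> 1 \<and> T \<subseteq> (g ^^ p) ` A \<and> T \<subseteq> (g ^^ r) ` B)"

lemma horseshoe_funpow:
  assumes "horseshoe (f ^^ m)" "m \<ge> 1" shows "horseshoe f"
proof -
  obtain A B T p r where *: "closed A" "closed B" "A \<inter> B = {}" "A \<subseteq> T" "B \<subseteq> T" "T \<subseteq> II" "T \<noteq> {}"
     "p \<ge> 1" "r \<ge> 1" "T \<subseteq> ((f ^^ m) ^^ p) ` A" "T \<subseteq> ((f ^^ m) ^^ r) ` B"
    using assms unfolding horseshoe_def by blast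
  then show ?thesis
    unfolding horseshoe_def funpow_mult using assms(2)
    by (intro exI[of _ A] exI[of _ B] exI[of _ T] exI[of _ "m * p"] exI[of _ "m * r"])
       (auto simp: funpow_mult)
qed

text \<open>Conjugation by the flip of \<open>II\<close> preserves all the data; it reduces points
  moved to the left to points moved to the right.\<close>

lemma horseshoe_reflect:
  assumes "horseshoe (\<lambda>x. 1 - g (1 - x))" shows "horseshoe g"
proof -
  let ?g = "\<lambda>x. 1 - g (1 - x)" and ?R = "\<lambda>x::real. 1 - x"
  have pow: "(?g ^^ n) x = 1 - (g ^^ n) (1 - x)" for n x by (induction n) simp_all
  obtain A B T p r where *: "closed A" "closed B" "A \<inter> B = {}" "A \<subseteq> T" "B \<subseteq> T" "T \<subseteq> II" "T \<noteq> {}"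
     "p \<ge> 1" "r \<ge> 1" "T \<subseteq> (?g ^^ p) ` A" "T \<subseteq> (?g ^^ r) ` B"
    using assms unfolding horseshoe_def by blast
  have R: "?R ` X = ?R -` X" for X by (force simp: image_def)
  have cl: "closed (?R ` X)" if "closed X" for X
    unfolding R using that by (intro closed_vimage continuous_intros)
  have cov: "?R ` T \<subseteq> (g ^^ n) ` ?R ` X" if TX: "T \<subseteq> (?g ^^ n) ` X" for n X
  proof
    fix y assume "y \<in> ?R ` T"
    then have "1 - y \<in> T" by auto
    then obtain x where "x \<in> X" "1 - y = 1 - (g ^^ n) (1 - x)"
      using TX unfolding pow by blast
    then show "y \<in> (g ^^ n) ` ?R ` X" by auto
  qed
  have "?R ` A \<inter> ?R ` B = {}" "?R ` A \<subseteq> ?R ` T" "?R ` B \<subseteq> ?R ` T" "?R ` T \<subseteq> II" "?R ` T \<noteq> {}"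
    using *(3-7) by (auto simp: II_def)
  then show ?thesis unfolding horseshoe_def
    using cl *(1,2,8,9) cov[OF *(10)] cov[OF *(11)]
    by (intro exI[of _ "?R ` A"] exI[of _ "?R ` B"] exI[of _ "?R ` T"] exI[of _ p] exI[of _ r]) simp
qed

section \<open>Horseshoes forced by dense periodic points\<close>

lemma image_covers_interval:
  fixes h :: "real \<Rightarrow> real"
  assumes "continuous_on {x..y} h" "x \<le> y" "a = h x" "b = h y"
  shows "{a..b} \<subseteq> h ` {x..y}"
  using assms IVT'[of h x _ y] by fastforce

text \<open>Let \<open>e\<close> be the first point sent to \<open>v\<close>. A periodic point
  \<open>r\<close> below \<open>e\<close> must jump past \<open>e\<close> to some \<rho> before it
  can come back. Then \<open>{r..e}\<close> is stretched over \<open>{r..v}\<close> by the period of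
  \<open>r\<close>, and \<open>{\<rho>..v}\<close> by the iterate that leads \<rho> back to
  \<open>r\<close>.\<close>

lemma increasing_gap_horseshoe:
  assumes g: "self_map_I g" and uv: "u \<in> II" "v \<in> II" "u < v" "g u = u" "g v = v"
    and up: "\<And>x. u < x \<Longrightarrow> x < v \<Longrightarrow> x < g x"
    and dense: "\<And>c d. u \<le> c \<Longrightarrow> c < d \<Longrightarrow> d \<le> v \<Longrightarrow> \<exists>p\<in>{c<..<d}. \<exists>n\<ge>1. (g ^^ n) p = p"
  shows "horseshoe g"
proof -
  have sub: "{x..y} \<subseteq> II" if "u \<le> x" "y \<le> v" for x y
    using uv that by (auto simp: II_def)
  have cont: "continuous_on {x..y} (g ^^ n)" if "u \<le> x" "y \<le> v" for x y n
    using continuous_on_funpow[OF g] sub[OF that] continuous_on_subset by blast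
  have contg: "continuous_on {x..y} g" if "u \<le> x" "y \<le> v" for x y
    using cont[OF that, of 1] by simp
  have vfix: "(g ^^ n) v = v" for n using uv by (induction n) simp_all
  \<comment> \<open>If no value exceeded \<open>v\<close>, orbits in the gap would increase until
    they possibly stop at \<open>v\<close>, so none could be periodic.\<close>
  have "\<exists>x. u < x \<and> x < v \<and> g x > v"
  proof (rule ccontr)
    assume no: "\<not> ?thesis"
    obtain r n where r: "r \<in> {u<..<v}" "n \<ge> 1" "(g ^^ n) r = r" using dense[of u v] uv by blast
    have "k \<ge> 1 \<Longrightarrow> r < (g ^^ k) r \<and> (g ^^ k) r \<le> v" for k
    proof (induction k rule: nat_induct_at_least)
      case base then show ?case using r no up[of r] by force
    next
      case (Suc k)
      show ?case
      proof (cases "(g ^^ k) r = v")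
        case True then show ?thesis using uv Suc by simp
      next
        case False
        then have "u < (g ^^ k) r" "(g ^^ k) r < v" using Suc r by auto
        then show ?thesis using up[of "(g ^^ k) r"] no Suc by force
      qed
    qed
    from this[OF r(2)] show False using r(3) by simp
  qed
  then obtain x0 where x0: "u < x0" "x0 < v" "g x0 > v" by blast
  define Z where "Z = {u..v} \<inter> g -` {v..}"
  have "compact Z"
  proof -
    have "closed Z" unfolding Z_def using contg[of u v]
      by (intro continuous_closed_preimage) auto
    moreover have "bounded Z" unfolding Z_def by (rule bounded_subset[of "{u..v}"]) auto
    ultimately show ?thesis by (simp add: compact_eq_bounded_closed)
  qed
  moreover have "x0 \<in> Z" using x0 by (simp add: Z_def)
  ultimately obtain e where e: "e \<in> Z" "\<And>y. y \<in> Z \<Longrightarrow> e \<le> y"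
    using compact_attains_inf[of Z] by auto
  have eb: "u < e" "e < v"
    using e(1) e(2)[OF \<open>x0 \<in> Z\<close>] uv x0 unfolding Z_def by (auto simp: order_less_le)
  have below: "g x < v" if "u \<le> x" "x < e" for x
    using that e(2)[of x] eb unfolding Z_def by force
  have ge: "g e = v"
  proof (rule ccontr)
    assume "g e \<noteq> v"
    then have "g e > v" using e(1) by (auto simp: Z_def)
    then obtain y where y: "u \<le> y" "y \<le> e" "g y = v"
      using IVT'[of g u v e] contg[of u e] eb uv by auto
    then show False using below[of y] \<open>g e \<noteq> v\<close> by (cases "y = e") auto
  qed
  have gen: "(g ^^ n) e = v" if "n \<ge> 1" for n
    using that vfix[of "n - 1"] ge funpow_add_apply[of "n - 1" 1 g e] by simp
  obtain r j where r: "r \<in> {u<..<e}" "j \<ge> 1" "(g ^^ j) r = r" using dense[of u e] eb by auto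
  \<comment> \<open>Points below \<open>e\<close> have images below \<open>v\<close>, so the orbit
    cannot leap over \<open>{e..<v}\<close>; were it to stay below \<open>e\<close>, it would
    increase forever.\<close>
  have "\<exists>i. (g ^^ i) r \<in> {e..<v}"
  proof (rule ccontr)
    assume no: "\<not> ?thesis"
    have inc: "u < (g ^^ i) r \<and> (g ^^ i) r < e \<and> (i \<ge> 1 \<longrightarrow> r < (g ^^ i) r)" for i
    proof (induction i)
      case 0 then show ?case using r by simp
    next
      case (Suc i)
      then have *: "(g ^^ i) r < g ((g ^^ i) r)" "g ((g ^^ i) r) < v"
        using up[of "(g ^^ i) r"] below[of "(g ^^ i) r"] eb by auto
      have "g ((g ^^ i) r) \<notin> {e..<v}" using no by (metis funpow.simps(2) comp_apply)
      with * Suc r show ?case by (cases "i = 0") auto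
    qed
    show False using inc[of j] r by simp
  qed
  then obtain i where i: "(g ^^ i) r \<in> {e..<v}" by blast
  let ?\<rho> = "(g ^^ i) r"
  \<comment> \<open>Chosen so that \<open>k + i\<close> is a multiple of the period
    \<open>j\<close>. The multiple \<open>Suc i\<close> makes \<open>k\<close> positive whatever the
    size of \<open>i\<close>.\<close>
  define k where "k = j * Suc i - i"
  have k: "k + i = Suc i * j" "k \<ge> 1"
  proof -
    have "1 * Suc i \<le> j * Suc i" using r(2) by (intro mult_le_mono1)
    then show "k + i = Suc i * j" "k \<ge> 1" unfolding k_def by (simp_all add: mult.commute)
  qed
  have \<rho>: "(g ^^ k) ?\<rho> = r"
    using funpow_fixed[OF r(3), of "Suc i"] k by (metis funpow_add_apply)
  \<comment> \<open>Every positive iterate sends \<open>e\<close> to \<open>v\<close>, whereas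
    \<open>g ^^ k\<close> sends \<rho> to \<open>r < v\<close>.\<close>
  have "?\<rho> \<noteq> e" using \<rho> gen[OF k(2)] r eb by auto
  then have \<rho>b: "e < ?\<rho>" "?\<rho> < v" using i by auto
  have "{r..v} \<subseteq> (g ^^ j) ` {r..e}"
    using image_covers_interval[of r e "g ^^ j" r v] cont[of r e j] r eb gen[OF r(2)] by auto
  moreover have "{r..v} \<subseteq> (g ^^ k) ` {?\<rho>..v}"
    using image_covers_interval[of ?\<rho> v "g ^^ k" r v] cont[of ?\<rho> v k] \<rho> \<rho>b r eb vfix by auto
  moreover have "{r..e} \<inter> {?\<rho>..v} = {}" "{r..e} \<subseteq> {r..v}" "{?\<rho>..v} \<subseteq> {r..v}" "{r..v} \<noteq> {}"
    using \<rho>b r eb by auto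
  moreover have "{r..v} \<subseteq> II" using sub[of r v] r by simp
  ultimately show ?thesis
    unfolding horseshoe_def using r(2) k(2)
    by (intro exI[of _ "{r..e}"] exI[of _ "{?\<rho>..v}"] exI[of _ "{r..v}"] exI[of _ j] exI[of _ k]) simp
qed

text \<open>The nearest fixed points \<open>u\<close> and \<open>v\<close> on either side of
  \<open>z\<close> exist by compactness of the fixed point sets \<open>F\<close>. Between them the
  direction of motion is constant, hence that of \<open>z\<close>.\<close>

lemma increasing_point_horseshoe:
  assumes g: "self_map_I g" and pq: "p \<in> II" "q \<in> II" "g p = p" "g q = q"
    and z: "p < z" "z < q" "z < g z"
    and dense: "\<And>c d. p \<le> c \<Longrightarrow> c < d \<Longrightarrow> d \<le> q \<Longrightarrow> \<exists>x\<in>{c<..<d}. \<exists>n\<ge>1. (g ^^ n) x = x"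
  shows "horseshoe g"
proof -
  define F where "F a b = {a..b} \<inter> (\<lambda>x. g x - x) -` {0}" for a b
  have comp: "compact (F a b)" if "p \<le> a" "b \<le> q" for a b
  proof -
    have "continuous_on {a..b} g"
    proof (rule continuous_on_subset)
      show "continuous_on II g" using g by (simp add: self_map_I_def)
      show "{a..b} \<subseteq> II" using that pq by (auto simp: II_def)
    qed
    then have "closed (F a b)" unfolding F_def
      by (intro continuous_closed_preimage continuous_intros) auto
    moreover have "bounded (F a b)" unfolding F_def by (rule bounded_subset[of "{a..b}"]) auto
    ultimately show ?thesis by (simp add: compact_eq_bounded_closed)
  qed
  have "p \<in> F p z" "q \<in> F z q" using pq z by (auto simp: F_def)
  then have ne: "F p z \<noteq> {}" "F z q \<noteq> {}" by blast+
  obtain u where u: "u \<in> F p z" "\<And>y. y \<in> F p z \<Longrightarrow> y \<le> u"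
    using compact_attains_sup[OF comp ne(1)] z by auto
  obtain v where v: "v \<in> F z q" "\<And>y. y \<in> F z q \<Longrightarrow> v \<le> y"
    using compact_attains_inf[OF comp ne(2)] z by auto
  have uv: "p \<le> u" "u < z" "z < v" "v \<le> q" "g u = u" "g v = v"
    using u(1) v(1) z by (auto simp: F_def order_less_le)
  have nofix: "g x \<noteq> x" if "x \<in> {u<..<v}" for x
    using u(2)[of x] v(2)[of x] that uv z by (cases "x \<le> z") (auto simp: F_def)
  have J: "is_interval {u<..<v}" "{u<..<v} \<subseteq> II"
    using uv pq by (auto simp: II_def is_interval_oo)
  have "x < g x" if "u < x" "x < v" for x
    using no_fixed_point_same_side[OF _ J nofix, where s=1 and x = z and y = x] g that uv z
    by (auto simp: self_map_I_def)
  moreover have "u \<in> II" "v \<in> II" using uv pq z by (auto simp: II_def)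
  ultimately show ?thesis
    using uv dense by (intro increasing_gap_horseshoe[OF g, of u v]) auto
qed

lemma nonidentity_horseshoe:
  assumes g: "self_map_I g" and pq: "p \<in> II" "q \<in> II" "g p = p" "g q = q"
    and z: "p < z" "z < q" "g z \<noteq> z"
    and dense: "\<And>c d. p \<le> c \<Longrightarrow> c < d \<Longrightarrow> d \<le> q \<Longrightarrow> \<exists>x\<in>{c<..<d}. \<exists>n\<ge>1. (g ^^ n) x = x"
  shows "horseshoe g"
proof (cases "z < g z")
  case True then show ?thesis using increasing_point_horseshoe[OF g pq z(1,2)] dense by blast
next
  case False
  let ?g = "\<lambda>x. 1 - g (1 - x)"
  have pow: "(?g ^^ n) x = 1 - (g ^^ n) (1 - x)" for n x by (induction n) simp_all
  have "continuous_on II ?g"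
    using g by (auto simp: self_map_I_def II_def intro!: continuous_intros continuous_on_compose2[of "{0..1}" g])
  moreover have "?g ` II \<subseteq> II"
  proof
    fix y assume "y \<in> ?g ` II"
    then obtain x where "1 - x \<in> II" "y = 1 - g (1 - x)" by (auto simp: II_def)
    then show "y \<in> II" using g by (force simp: self_map_I_def II_def image_subset_iff)
  qed
  ultimately have "self_map_I ?g" by (simp add: self_map_I_def)
  moreover have "\<exists>x\<in>{c<..<d}. \<exists>n\<ge>1. (?g ^^ n) x = x" if cd: "1 - q \<le> c" "c < d" "d \<le> 1 - p" for c d
  proof -
    obtain x n where "x \<in> {1 - d<..<1 - c}" "n \<ge> 1" "(g ^^ n) x = x"
      using dense[of "1 - d" "1 - c"] cd by auto
    then show ?thesis by (intro bexI[of _ "1 - x"] exI[of _ n]) (auto simp: pow)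
  qed
  moreover have "1 - q \<in> II" "1 - p \<in> II" "?g (1 - q) = 1 - q" "?g (1 - p) = 1 - p"
    "1 - q < 1 - z" "1 - z < 1 - p" "1 - z < ?g (1 - z)"
    using False z pq by (auto simp: II_def)
  ultimately have "horseshoe ?g" by (intro increasing_point_horseshoe)
  then show ?thesis by (rule horseshoe_reflect)
qed

section \<open>Independence\<close>

text \<open>Combinatorial independence of the pair \<open>A\<close>, \<open>B\<close> along the
  times \<open>S\<close>. A word in the two letters is encoded by the set \<sigma> of times that
  carry the letter \<open>B\<close>.\<close>

definition indep :: "(real \<Rightarrow> real) \<Rightarrow> real set \<Rightarrow> real set \<Rightarrow> nat set \<Rightarrow> bool" where
  "indep f A B S \<longleftrightarrow> finite S \<and>
     (\<forall>\<sigma>\<subseteq>S. \<exists>x\<in>II. (\<forall>s\<in>\<sigma>. (f ^^ s) x \<in> B) \<and> (\<forall>s\<in>S - \<sigma>. (f ^^ s) x \<in> A))"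

lemma indep_subset:
  assumes "indep f A B S" "S' \<subseteq> S" shows "indep f A B S'"
  unfolding indep_def
proof (intro conjI allI impI)
  show "finite S'" using assms finite_subset unfolding indep_def by blast
  fix \<sigma> assume \<sigma>: "\<sigma> \<subseteq> S'"
  then obtain x where "x \<in> II" "\<forall>s\<in>\<sigma>. (f ^^ s) x \<in> B" "\<forall>s\<in>S - \<sigma>. (f ^^ s) x \<in> A"
    using assms unfolding indep_def by (meson order_trans)
  then show "\<exists>x\<in>II. (\<forall>s\<in>\<sigma>. (f ^^ s) x \<in> B) \<and> (\<forall>s\<in>S' - \<sigma>. (f ^^ s) x \<in> A)"
    using assms(2) by blast
qed

lemma covers_iterate:
  assumes "T \<subseteq> (f ^^ p) ` A" "A \<subseteq> T" shows "k \<ge> 1 \<Longrightarrow> T \<subseteq> (f ^^ (p * k)) ` A"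
proof (induction k rule: nat_induct_at_least)
  case (Suc k)
  show ?case
  proof
    fix y assume "y \<in> T"
    then obtain x where x: "x \<in> A" "y = (f ^^ (p * k)) x" using Suc by blast
    then obtain w where "w \<in> A" "x = (f ^^ p) w" using assms by blast
    then show "y \<in> (f ^^ (p * Suc k)) ` A"
      using x by (auto simp: funpow_add_apply[symmetric] add.commute)
  qed
qed (use assms in simp)

text \<open>Any word in \<open>A\<close> and \<open>B\<close> is realised along the multiples of
  \<open>N\<close> by pulling back through the coverings, starting from its last letter.\<close>

lemma horseshoe_indep:
  assumes "horseshoe f"
  shows "\<exists>A B. closed A \<and> closed B \<and> A \<inter> B = {} \<and> (\<forall>k. \<exists>S. indep f A B S \<and> card S = k)"
proof -
  obtain A B T p r where *: "closed A" "closed B" "A \<inter> B = {}" "A \<subseteq> T" "B \<subseteq> T" "T \<subseteq> II" "T \<noteq> {}"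
     "p \<ge> 1" "r \<ge> 1" "T \<subseteq> (f ^^ p) ` A" "T \<subseteq> (f ^^ r) ` B"
    using assms unfolding horseshoe_def by blast
  \<comment> \<open>A common multiple of the two iterates, so that both branches cover
    \<open>T\<close> in the same time.\<close>
  define N where "N = p * r"
  have N: "N \<ge> 1" using *(8,9) by (simp add: N_def)
  have cov: "T \<subseteq> (f ^^ N) ` A" "T \<subseteq> (f ^^ N) ` B"
    using covers_iterate[OF *(10,4) *(9)] covers_iterate[OF *(11,5) *(8)]
    by (simp_all add: N_def mult.commute)
  have itin: "\<exists>x\<in>T. \<forall>i<k. (f ^^ (N * i)) x \<in> (if P i then B else A)" for P k
  proof (induction k arbitrary: P)
    case 0 then show ?case using *(7) by auto
  next
    case (Suc k)
    obtain x where x: "x \<in> T" "\<forall>i<k. (f ^^ (N * i)) x \<in> (if P (Suc i) then B else A)"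
      using Suc[of "\<lambda>i. P (Suc i)"] by blast
    obtain w where w: "w \<in> (if P 0 then B else A)" "(f ^^ N) w = x"
      using subsetD[OF cov(1) x(1)] subsetD[OF cov(2) x(1)] by (cases "P 0") auto
    have "(f ^^ (N * i)) w \<in> (if P i then B else A)" if "i < Suc k" for i
    proof (cases i)
      case (Suc i')
      have "(f ^^ (N * i)) w = (f ^^ (N * i')) x"
        using w(2) Suc funpow_add_apply[of "N * i'" N f w] by (simp add: add.commute)
      then show ?thesis using x(2) Suc that by auto
    qed (use w in simp)
    moreover have "w \<in> T" using w(1) *(4,5) by (auto split: if_splits)
    ultimately show ?case by blast
  qed
  have "\<exists>S. indep f A B S \<and> card S = k" for k
  proof (intro exI conjI)
    let ?S = "(\<lambda>i. N * i) ` {..<k}"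
    have inj: "inj ((*) N)" using N by (auto simp: inj_def)
    then show "card ?S = k" by (simp add: card_image inj_on_subset)
    show "indep f A B ?S" unfolding indep_def
    proof (intro conjI allI impI)
      fix \<sigma> assume \<sigma>: "\<sigma> \<subseteq> ?S"
      obtain x where x: "x \<in> T" "\<forall>i<k. (f ^^ (N * i)) x \<in> (if N * i \<in> \<sigma> then B else A)"
        using itin[of k "\<lambda>i. N * i \<in> \<sigma>"] by blast
      have AB: "(f ^^ s) x \<in> (if s \<in> \<sigma> then B else A)" if "s \<in> ?S" for s using x(2) that by auto
      then have "(f ^^ s) x \<in> B" if "s \<in> \<sigma>" for s using that \<sigma> by (metis subsetD)
      moreover have "(f ^^ s) x \<in> A" if "s \<in> ?S - \<sigma>" for s
        using that AB by (metis DiffD1 DiffD2)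
      ultimately show "\<exists>x\<in>II. (\<forall>s\<in>\<sigma>. (f ^^ s) x \<in> B) \<and> (\<forall>s\<in>?S - \<sigma>. (f ^^ s) x \<in> A)"
        using x(1) *(6) by blast
    qed simp
  qed
  then show ?thesis using *(1-3) by blast
qed

section \<open>Nullness bounds the size of independence sets\<close>

lemma Ncov_le:
  assumes "\<V> \<subseteq> \<U>" "finite \<V>" "II \<subseteq> \<Union>\<V>" shows "Ncov \<U> \<le> card \<V>"
  unfolding Ncov_def using assms by (intro Least_le) blast

text \<open>The least number in \<open>Ncov\<close> is meaningful only once some finite subcover is
  known, hence the assumptions on \<V>.\<close>

lemma Ncov_attained:
  assumes "\<V> \<subseteq> \<U>" "finite \<V>" "II \<subseteq> \<Union>\<V>"
  obtains \<W> where "\<W> \<subseteq> \<U>" "finite \<W>" "II \<subseteq> \<Union>\<W>" "card \<W> = Ncov \<U>"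
proof -
  let ?P = "\<lambda>k. \<exists>\<V>\<subseteq>\<U>. finite \<V> \<and> card \<V> = k \<and> II \<subseteq> \<Union>\<V>"
  have "?P (card \<V>)" using assms by blast
  then have "?P (Ncov \<U>)" unfolding Ncov_def by (rule LeastI)
  then show thesis using that by blast
qed

text \<open>Points with equal keys share a cover element at each time, so one cell of the join per
  key suffices. Counting cells thus becomes counting keys.\<close>

lemma join_cover_by_keys:
  assumes fin: "finite (key ` II)"
    and same: "\<And>\<kappa> i. i < n \<Longrightarrow> \<exists>U\<in>\<U>. \<forall>x\<in>II. key x = \<kappa> \<longrightarrow> (f ^^ t i) x \<in> U"
  obtains \<V> where "\<V> \<subseteq> join_cover f t n \<U>" "finite \<V>" "II \<subseteq> \<Union>\<V>" "card \<V> \<le> card (key ` II)"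
proof -
  have "\<forall>\<kappa> i. \<exists>U. i < n \<longrightarrow> U \<in> \<U> \<and> (\<forall>x\<in>II. key x = \<kappa> \<longrightarrow> (f ^^ t i) x \<in> U)"
    using same by blast
  then obtain u where u: "\<And>\<kappa> i. i < n \<Longrightarrow> u \<kappa> i \<in> \<U> \<and> (\<forall>x\<in>II. key x = \<kappa> \<longrightarrow> (f ^^ t i) x \<in> u \<kappa> i)"
    by metis
  define cell where "cell \<kappa> = II \<inter> (\<Inter>i\<in>{..<n}. (f ^^ t i) -` u \<kappa> i \<inter> II)" for \<kappa>
  have "cell \<kappa> \<in> join_cover f t n \<U>" for \<kappa>
    unfolding cell_def join_cover_def pre_cover_def using u by blast
  then have "cell ` key ` II \<subseteq> join_cover f t n \<U>" by blast
  moreover have "x \<in> cell (key x)" if "x \<in> II" for x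
    using that u unfolding cell_def by auto
  then have "II \<subseteq> \<Union>(cell ` key ` II)" by blast
  ultimately show thesis using that fin card_image_le by blast
qed

lemma finite_subcover_join_cover:
  assumes f: "self_map_I f" and \<U>: "open_cover \<U>"
  obtains \<V> where "\<V> \<subseteq> join_cover f t n \<U>" "finite \<V>" "II \<subseteq> \<Union>\<V>"
proof -
  define el where "el y = (SOME U. U \<in> \<U> \<and> y \<in> U)" for y
  have el: "el y \<in> \<U> \<and> y \<in> el y" if "y \<in> II" for y
    unfolding el_def by (rule someI_ex) (use \<U> that in \<open>auto simp: open_cover_def\<close>)
  define key where "key x = (\<lambda>i\<in>{..<n}. el ((f ^^ t i) x))" for x
  have "key ` II \<subseteq> PiE {..<n} (\<lambda>_. \<U>)"
    using el funpow_in_II[OF f] by (auto simp: key_def)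
  then have fin: "finite (key ` II)"
    using \<U> finite_PiE[of "{..<n}" "\<lambda>_. \<U>"] finite_subset by (auto simp: open_cover_def)
  have same: "\<exists>U\<in>\<U>. \<forall>x\<in>II. key x = \<kappa> \<longrightarrow> (f ^^ t i) x \<in> U" if i: "i < n" for \<kappa> i
  proof (cases "\<kappa> \<in> key ` II")
    case True
    then obtain x0 where "x0 \<in> II" "\<kappa> = key x0" by blast
    then have "\<kappa> i \<in> \<U>" using i el funpow_in_II[OF f] by (simp add: key_def)
    moreover have "(f ^^ t i) x \<in> \<kappa> i" if "x \<in> II" "key x = \<kappa>" for x
      using el[OF funpow_in_II[OF f that(1)], of "t i"] that(2) i unfolding key_def by auto
    ultimately show ?thesis by blast
  next
    \<comment> \<open>A key that no point attains imposes no condition; any element of \<U> will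
      do.\<close>
    case False
    have "\<exists>U. U \<in> \<U>" using el[of 0] by (auto simp: II_def)
    then show ?thesis using False by blast
  qed
  show thesis by (rule join_cover_by_keys[OF fin same]) (use that in auto)
qed

text \<open>Points realising different words are in \<open>A\<close> and \<open>B\<close>
  respectively at some time of \<open>S\<close>, while each element of the cover misses
  \<open>A\<close> or \<open>B\<close>. So no cell contains two of them.\<close>

lemma indep_Ncov_ge:
  assumes f: "self_map_I f" and AB: "A \<inter> B = {}" "open_cover {II - A, II - B}"
    and S: "indep f A B S" "S \<subseteq> t ` {..<n}"
  shows "2 ^ card S \<le> Ncov (join_cover f t n {II - A, II - B})"
proof -
  obtain \<V> where V: "\<V> \<subseteq> join_cover f t n {II - A, II - B}" "finite \<V>" "II \<subseteq> \<Union>\<V>"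
    using finite_subcover_join_cover[OF f AB(2)] by blast
  obtain \<W> where W: "\<W> \<subseteq> join_cover f t n {II - A, II - B}" "finite \<W>" "II \<subseteq> \<Union>\<W>"
    "card \<W> = Ncov (join_cover f t n {II - A, II - B})"
    using Ncov_attained[OF V] .
  have "\<forall>\<sigma>. \<exists>x. \<sigma> \<subseteq> S \<longrightarrow> x \<in> II \<and> (\<forall>s\<in>\<sigma>. (f ^^ s) x \<in> B) \<and> (\<forall>s\<in>S - \<sigma>. (f ^^ s) x \<in> A)"
    using S(1) unfolding indep_def by blast
  then obtain x where x: "\<And>\<sigma>. \<sigma> \<subseteq> S \<Longrightarrow> x \<sigma> \<in> II"
    "\<And>\<sigma> s. \<sigma> \<subseteq> S \<Longrightarrow> s \<in> \<sigma> \<Longrightarrow> (f ^^ s) (x \<sigma>) \<in> B"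
    "\<And>\<sigma> s. \<sigma> \<subseteq> S \<Longrightarrow> s \<in> S - \<sigma> \<Longrightarrow> (f ^^ s) (x \<sigma>) \<in> A"
    by metis
  have "\<forall>\<sigma>. \<exists>w. \<sigma> \<subseteq> S \<longrightarrow> w \<in> \<W> \<and> x \<sigma> \<in> w" using x(1) W(3) by blast
  then obtain w where w: "\<And>\<sigma>. \<sigma> \<subseteq> S \<Longrightarrow> w \<sigma> \<in> \<W>" "\<And>\<sigma>. \<sigma> \<subseteq> S \<Longrightarrow> x \<sigma> \<in> w \<sigma>" by metis
  have sub: "\<sigma> \<subseteq> \<tau>" if \<sigma>: "\<sigma> \<subseteq> S" and \<tau>: "\<tau> \<subseteq> S" and eq: "w \<sigma> = w \<tau>" for \<sigma> \<tau>
  proof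
    fix s assume s: "s \<in> \<sigma>"
    show "s \<in> \<tau>"
    proof (rule ccontr)
      assume "s \<notin> \<tau>"
      then have *: "(f ^^ s) (x \<sigma>) \<in> B" "(f ^^ s) (x \<tau>) \<in> A" using x s \<sigma> \<tau> by blast+
      obtain i where i: "i < n" "s = t i" using s \<sigma> S(2) by blast
      obtain g where g: "w \<sigma> = II \<inter> (\<Inter>i\<in>{..<n}. g i)" "\<forall>i<n. g i \<in> pre_cover f (t i) {II - A, II - B}"
        using w(1)[OF \<sigma>] W(1) unfolding join_cover_def by blast
      have "x \<sigma> \<in> g i" "x \<tau> \<in> g i" using w(2)[OF \<sigma>] w(2)[OF \<tau>] eq g(1) i(1) by auto
      then show False using g(2) i * unfolding pre_cover_def by auto
    qed
  qed
  have "inj_on w (Pow S)" by (rule inj_onI) (use sub in blast)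
  moreover have "w ` Pow S \<subseteq> \<W>" using w(1) by blast
  ultimately have "card (Pow S) \<le> card \<W>" using W(2) card_inj_on_le by blast
  moreover have "finite S" using S(1) by (simp add: indep_def)
  ultimately show ?thesis using W(4) by (simp add: card_Pow)
qed

text \<open>The indices of the terms in \<open>P\<close> form a down-closed set, hence an initial
  segment, whose length is \<open>card P\<close> by injectivity.\<close>

lemma strict_mono_initial_segment:
  fixes t :: "nat \<Rightarrow> nat"
  assumes t: "strict_mono t" and P: "P \<subseteq> range t" "finite P"
    and init: "\<And>i p. p \<in> P \<Longrightarrow> t i \<le> p \<Longrightarrow> t i \<in> P"
  shows "t ` {..<card P} = P"
proof -
  define I where "I = {i. t i \<in> P}"
  have inj: "inj t" using t strict_mono_imp_inj_on by blast
  have img: "t ` I = P" using P(1) by (auto simp: I_def)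
  have finI: "finite I" using P(2) img inj by (metis finite_imageD inj_on_subset subset_UNIV)
  have down: "i \<in> I" if "j \<in> I" "i \<le> j" for i j
    using that init[of "t j" i] strict_mono_mono[OF t] by (auto simp: I_def monoD)
  have "I = {..<card I}"
  proof (cases "I = {}")
    case False
    have "I = {..Max I}" using down Max_in[OF finI False] Max_ge[OF finI] by auto
    then show ?thesis by (metis card_atMost lessThan_Suc_atMost)
  qed simp
  moreover have "card I = card P" using img inj card_image inj_on_subset by (metis subset_UNIV)
  ultimately show ?thesis using img by simp
qed

text \<open>Independence sets of growing size, each dominating all earlier ones together, are
  concatenated into one sequence along which the entropy is at least \<open>ln 2 / 2\<close>.\<close>

lemma null_map_bounded_indep:
  assumes f: "self_map_I f" and null: "null_map f"
    and AB: "closed A" "closed B" "A \<inter> B = {}"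
  shows "\<exists>d. \<forall>S. indep f A B S \<longrightarrow> card S \<le> d"
proof (rule ccontr)
  assume "\<not> ?thesis"
  then have big: "\<exists>S. indep f A B S \<and> card S > d" for d by (meson not_le)
  define Q where "Q P F \<longleftrightarrow> indep f A B F \<and> card P < card F \<and> (\<forall>p\<in>P. \<forall>s\<in>F. p < s)" for P F :: "nat set"
  \<comment> \<open>Discarding the times below \<open>M\<close> loses at most \<open>M\<close>
    elements of a large independence set, and what remains is still independent.\<close>
  have ex: "\<exists>F. Q P F" if P: "finite P" for P
  proof -
    obtain M where M: "\<forall>p\<in>P. p < M" using P finite_nat_set_iff_bounded by blast
    obtain S where S: "indep f A B S" "card S > M + card P" using big by blast
    have "card S \<le> card (S \<inter> {M..}) + card {..<M}"
      by (rule order_trans[OF card_mono card_Un_le]) (use S in \<open>auto simp: indep_def\<close>)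
    then have "card P < card (S \<inter> {M..})" using S(2) by simp
    moreover have "indep f A B (S \<inter> {M..})" using indep_subset[OF S(1)] by blast
    ultimately show ?thesis using M unfolding Q_def by force
  qed
  define F where "F P = (SOME F. Q P F)" for P
  define P where "P k = ((\<lambda>P. P \<union> F P) ^^ k) {}" for k
  have P_Suc: "P (Suc k) = P k \<union> F (P k)" for k by (simp add: P_def)
  have QF: "Q P (F P)" if "finite P" for P unfolding F_def using ex[OF that] by (rule someI_ex)
  have finP: "finite (P k)" for k
  proof (induction k)
    case (Suc k) then show ?case using QF[OF Suc] by (simp add: P_Suc Q_def indep_def)
  qed (simp add: P_def)
  note Q = QF[OF finP]
  have finF: "finite (F (P k))" for k using Q[of k] by (simp add: Q_def indep_def)
  have cardP: "card (P (Suc k)) = card (P k) + card (F (P k))" for k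
    unfolding P_Suc using Q[of k] finP finF by (intro card_Un_disjoint) (auto simp: Q_def)
  have cardk: "k \<le> card (P k)" for k
  proof (induction k)
    case (Suc k) then show ?case using Q[of k] by (simp add: cardP Q_def)
  qed simp
  have monoP: "mono P" by (rule mono_iff_le_Suc[THEN iffD2]) (auto simp: P_Suc)
  \<comment> \<open>Each block lies to the right of all earlier ones, so every stage
    \<open>P k\<close> is an initial segment of the union and consists of the first terms of
    \<open>t\<close>.\<close>
  have init: "p \<in> P k" if "p \<in> P l" "p \<le> p'" "p' \<in> P k" for p p' k l
    using that(1)
  proof (induction l)
    case (Suc l)
    show ?case
    proof (cases "p \<in> P l \<or> l < k")
      case True then show ?thesis using Suc monoD[OF monoP, of "Suc l" k] by auto
    next
      case False
      then have "P k \<subseteq> P l" "p \<in> F (P l)" using Suc monoD[OF monoP, of k l] by (auto simp: P_Suc)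
      then have "p' < p" using that(3) Q[of l] by (auto simp: Q_def)
      then show ?thesis using that(2) by simp
    qed
  qed (simp add: P_def)
  define \<A> where "\<A> = (\<Union>k. P k)"
  have infA: "infinite \<A>"
  proof
    assume "finite \<A>"
    then have "card (P (Suc (card \<A>))) \<le> card \<A>" by (intro card_mono) (auto simp: \<A>_def)
    then show False using cardk[of "Suc (card \<A>)"] by simp
  qed
  define t where "t = enumerate \<A>"
  have t: "strict_mono t" "range t = \<A>"
    using infA by (simp_all add: t_def strict_mono_enumerate range_enumerate)
  have tP: "t ` {..<card (P k)} = P k" for k
  proof (rule strict_mono_initial_segment[OF t(1) _ finP])
    show "P k \<subseteq> range t" by (auto simp: t(2) \<A>_def)
    fix i p assume p: "p \<in> P k" "t i \<le> p"
    have "t i \<in> \<A>" using t(2) by blast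
    then show "t i \<in> P k" using init p by (auto simp: \<A>_def)
  qed
  let ?U = "{II - A, II - B}"
  have "openin (top_of_set II) (II - C)" if "closed C" for C
    using that by (metis Diff_eq closed_def openin_open_Int)
  then have U: "open_cover ?U" using AB by (auto simp: open_cover_def)
  let ?e = "\<lambda>n. ereal (ln (real (Ncov (join_cover f t n ?U))) / real n)"
  \<comment> \<open>The last block makes up more than half of the first \<open>?n\<close> times, so
    at least \<open>2 ^ ?m\<close> cells with \<open>?m > ?n / 2\<close> are required.\<close>
  have low: "ereal (ln 2 / 2) \<le> ?e (card (P (Suc k)))" for k
  proof -
    let ?n = "card (P (Suc k))" and ?m = "card (F (P k))"
    have n: "?n < 2 * ?m" "0 < ?n" using Q[of k] by (auto simp: cardP Q_def)
    have "2 ^ ?m \<le> Ncov (join_cover f t ?n ?U)"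
      using indep_Ncov_ge[OF f AB(3) U, of "F (P k)" t ?n] Q[of k] tP[of "Suc k"]
      by (auto simp: Q_def P_Suc)
    then have "real (2 ^ ?m) \<le> real (Ncov (join_cover f t ?n ?U))" by (rule of_nat_mono)
    then have "ln (2 ^ ?m) \<le> ln (real (Ncov (join_cover f t ?n ?U)))"
      by (intro ln_mono) simp_all
    then have "real ?m * ln 2 \<le> ln (real (Ncov (join_cover f t ?n ?U)))"
      by (simp add: ln_realpow)
    moreover have "real ?n / 2 * ln 2 \<le> real ?m * ln 2"
      using n(1) by (intro mult_right_mono) simp_all
    ultimately have "ln 2 / 2 * real ?n \<le> ln (real (Ncov (join_cover f t ?n ?U)))"
      by (simp only: mult.commute times_divide_eq_right)
    then show ?thesis using n(2) by (simp add: pos_le_divide_eq)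
  qed
  have "ereal (ln 2 / 2) \<le> limsup ?e"
    unfolding limsup_INF_SUP
  proof (rule INF_greatest)
    fix N
    show "ereal (ln 2 / 2) \<le> (SUP n\<in>{N..}. ?e n)"
      using cardk[of "Suc N"] by (intro SUP_upper2[where i = "card (P (Suc N))"] low) simp
  qed
  also have "\<dots> \<le> seq_entropy f t"
    unfolding seq_entropy_def seq_entropy_cover_def using U by (intro SUP_upper2[of ?U]) auto
  also have "\<dots> \<le> (SUP t\<in>{t. strict_mono t}. seq_entropy f t)" using t(1) by (intro SUP_upper) simp
  also have "\<dots> = 0" using null by (simp add: null_map_def)
  finally show False by (simp add: zero_ereal_def)
qed

section \<open>Every gap contains a tame subinterval\<close>

text \<open>If both alternatives fail on every subinterval, periodic points are dense and no iterate
  is the identity on an interval. The resulting horseshoe has independence sets of every size, which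
  nullness forbids.\<close>

lemma tame_subinterval:
  assumes f: "self_map_I f" and null: "null_map f" and ab: "0 \<le> a" "a < b" "b \<le> 1"
  shows "\<exists>c d. a \<le> c \<and> c < d \<and> d \<le> b \<and>
    ((\<exists>K. \<forall>x\<in>II. \<forall>S. finite S \<and> (\<forall>t\<in>S. (f ^^ t) x \<in> {c<..<d}) \<longrightarrow> card S \<le> K) \<or>
     (\<exists>k\<ge>1. \<forall>x\<in>{c<..<d}. (f ^^ k) x = x))"
proof (rule ccontr)
  assume no: "\<not> ?thesis"
  have ret: "\<exists>x\<in>II. \<exists>S. finite S \<and> (\<forall>t\<in>S. (f ^^ t) x \<in> {c<..<d}) \<and> card S > K"
    if "a \<le> c" "c < d" "d \<le> b" for c d K
    using no that by (meson not_le)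
  have per: "\<exists>p\<in>{c<..<d}. \<exists>n\<ge>1. (f ^^ n) p = p" if "a \<le> c" "c < d" "d \<le> b" for c d
    using dense_periodic_points[OF f ab(1,3) ret that] by blast
  obtain p n1 where p: "p \<in> {a<..<b}" "n1 \<ge> 1" "(f ^^ n1) p = p" using per[of a b] ab by auto
  obtain q n2 where q: "q \<in> {p<..<b}" "n2 \<ge> 1" "(f ^^ n2) q = q" using per[of p b] p by auto
  \<comment> \<open>A common period turns \<open>p\<close> and \<open>q\<close> into fixed points of
    one map.\<close>
  define m where "m = n1 * n2"
  have m: "m \<ge> 1" "(f ^^ m) p = p" "(f ^^ m) q = q"
    using p q funpow_fixed[OF p(3), of n2] funpow_fixed[OF q(3), of n1] by (auto simp: m_def mult.commute)
  obtain z where z: "z \<in> {p<..<q}" "(f ^^ m) z \<noteq> z"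
    using no m(1) p q by (metis greaterThanLessThan_iff less_imp_le)
  have "\<exists>x\<in>{c<..<d}. \<exists>n\<ge>1. ((f ^^ m) ^^ n) x = x" if cd: "p \<le> c" "c < d" "d \<le> q" for c d
  proof -
    obtain x n where x: "x \<in> {c<..<d}" "n \<ge> 1" "(f ^^ n) x = x"
      using per[of c d] cd p q by auto
    have "((f ^^ m) ^^ n) x = x" using funpow_fixed[OF x(3), of m] by (simp add: funpow_mult)
    then show ?thesis using x by blast
  qed
  moreover have "p \<in> II" "q \<in> II" using p q ab by (auto simp: II_def)
  ultimately have "horseshoe (f ^^ m)"
    using nonidentity_horseshoe[OF self_map_I_funpow[OF f], of p q m z] m z by auto
  then have "horseshoe f" using horseshoe_funpow m(1) by blast
  then obtain A B where AB: "closed A" "closed B" "A \<inter> B = {}" "\<forall>k. \<exists>S. indep f A B S \<and> card S = k"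
    using horseshoe_indep by metis
  then obtain D where "\<forall>S. indep f A B S \<longrightarrow> card S \<le> D" using null_map_bounded_indep[OF f null] by blast
  then show False using AB(4) by (metis Suc_n_not_le_n)
qed

section \<open>Counting subsets by shattered sets\<close>

definition shattered :: "'a set set \<Rightarrow> 'a set \<Rightarrow> bool" where
  "shattered \<F> S \<longleftrightarrow> (\<forall>\<sigma>\<subseteq>S. \<exists>R\<in>\<F>. R \<inter> S = \<sigma>)"

text \<open>Pajor's form of the Sauer--Shelah lemma. Split the family into \<open>F0\<close>, the
  members without \<open>a\<close>, and \<open>F1\<close>, the members with \<open>a\<close>, which
  is then deleted. A set shattered by one part is shattered by \<F>; if shattered by both, so is the
  set with \<open>a\<close> added.\<close>

lemma card_le_shattered:
  assumes "finite X" "\<F> \<subseteq> Pow X"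
  shows "card \<F> \<le> card {S. S \<subseteq> X \<and> shattered \<F> S}"
  using assms
proof (induction X arbitrary: \<F> rule: finite_induct)
  case empty
  show ?case
  proof (cases "\<F> = {}")
    case False
    then have "\<F> = {{}}" using empty by auto
    then have "{S. S \<subseteq> {} \<and> shattered \<F> S} = {{}}" by (auto simp: shattered_def)
    then show ?thesis using \<open>\<F> = {{}}\<close> by simp
  qed simp
next
  case (insert a X)
  define F0 where "F0 = {R\<in>\<F>. a \<notin> R}"
  define F1 where "F1 = {R. a \<notin> R \<and> insert a R \<in> \<F>}"
  define sh where "sh \<G> = {S. S \<subseteq> X \<and> shattered \<G> S}" for \<G>
  let ?S = "{S. S \<subseteq> insert a X \<and> shattered \<F> S}"
  have fin: "finite (sh \<G>)" for \<G> using insert.hyps(1) by (simp add: sh_def)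
  have sub: "F0 \<subseteq> Pow X" "F1 \<subseteq> Pow X" using insert.prems by (auto simp: F0_def F1_def)
  have F: "\<F> = F0 \<union> insert a ` F1"
  proof (intro equalityI subsetI)
    fix R assume R: "R \<in> \<F>"
    show "R \<in> F0 \<union> insert a ` F1"
    proof (cases "a \<in> R")
      case True
      then have "R - {a} \<in> F1" "R = insert a (R - {a})" using R by (auto simp: F1_def insert_absorb)
      then show ?thesis by blast
    qed (use R in \<open>simp add: F0_def\<close>)
  qed (auto simp: F0_def F1_def)
  have "inj_on (insert a) F1" by (auto simp: inj_on_def F1_def)
  then have c1: "card (insert a ` F1) = card F1" by (rule card_image)
  have "card \<F> \<le> card F0 + card F1" using F c1 card_Un_le[of F0 "insert a ` F1"] by simp
  also have "\<dots> \<le> card (sh F0) + card (sh F1)"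
    unfolding sh_def using insert.IH sub by (intro add_mono) auto
  \<comment> \<open>Sets shattered by both parts are counted twice; the second copy is traded for
    the set enlarged by \<open>a\<close>.\<close>
  also have "\<dots> = card (sh F0 \<union> sh F1) + card (sh F0 \<inter> sh F1)" by (rule card_Un_Int[OF fin fin])
  also have "card (sh F0 \<inter> sh F1) = card (insert a ` (sh F0 \<inter> sh F1))"
  proof (rule card_image[symmetric])
    have "a \<notin> S" if "S \<in> sh F0" for S using that insert.hyps(2) by (auto simp: sh_def)
    then show "inj_on (insert a) (sh F0 \<inter> sh F1)" by (intro inj_onI) (simp add: insert_ident)
  qed
  also have "card (sh F0 \<union> sh F1) + card (insert a ` (sh F0 \<inter> sh F1))
      = card ((sh F0 \<union> sh F1) \<union> insert a ` (sh F0 \<inter> sh F1))"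
    using fin insert.hyps(2) by (intro card_Un_disjoint[symmetric]) (auto simp: sh_def)
  also have "\<dots> \<le> card ?S"
  proof (rule card_mono)
    show "finite ?S" using insert.hyps(1) by simp
    have "S \<in> ?S" if S: "S \<in> sh F0 \<union> sh F1" for S
    proof -
      have aS: "a \<notin> S" "S \<subseteq> insert a X" using S insert.hyps(2) by (auto simp: sh_def)
      have "\<exists>R\<in>\<F>. R \<inter> S = \<sigma>" if \<sigma>: "\<sigma> \<subseteq> S" for \<sigma>
      proof (cases "S \<in> sh F0")
        case True
        then have "shattered F0 S" by (simp add: sh_def)
        then show ?thesis using \<sigma> F unfolding shattered_def by blast
      next
        case False
        then have "shattered F1 S" using S by (auto simp: sh_def)
        then obtain R where "R \<in> F1" "R \<inter> S = \<sigma>" using \<sigma> unfolding shattered_def by blast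
        then have "insert a R \<in> \<F>" "insert a R \<inter> S = \<sigma>" using aS by (auto simp: F1_def)
        then show ?thesis by blast
      qed
      then show ?thesis using aS by (simp add: shattered_def)
    qed
    moreover have "insert a S \<in> ?S" if S: "S \<in> sh F0 \<inter> sh F1" for S
    proof -
      have aS: "a \<notin> S" "insert a S \<subseteq> insert a X" using S insert.hyps(2) by (auto simp: sh_def)
      have sh: "shattered F0 S" "shattered F1 S" using S by (simp_all add: sh_def)
      have "\<exists>R\<in>\<F>. R \<inter> insert a S = \<sigma>" if \<sigma>: "\<sigma> \<subseteq> insert a S" for \<sigma>
      proof -
        have \<sigma>': "\<sigma> - {a} \<subseteq> S" using \<sigma> by blast
        show ?thesis
        proof (cases "a \<in> \<sigma>")
          case True
          obtain R where R: "R \<in> F1" "R \<inter> S = \<sigma> - {a}" using sh(2) \<sigma>' unfolding shattered_def by blast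
          then have "insert a R \<inter> insert a S = \<sigma>" using True by auto
          then show ?thesis using F R by blast
        next
          case False
          obtain R where R: "R \<in> F0" "R \<inter> S = \<sigma> - {a}" using sh(1) \<sigma>' unfolding shattered_def by blast
          then have "R \<inter> insert a S = \<sigma>" using False by (auto simp: F0_def)
          then show ?thesis using F R by blast
        qed
      qed
      then show ?thesis using aS by (simp add: shattered_def)
    qed
    ultimately show "(sh F0 \<union> sh F1) \<union> insert a ` (sh F0 \<inter> sh F1) \<subseteq> ?S" by blast
  qed
  finally show ?case .
qed

text \<open>Such a set is built in \<open>D\<close> rounds, each adding one element of
  \<open>X\<close> or nothing (\<open>None\<close>).\<close>

lemma card_small_subsets_le:
  assumes "finite X"
  shows "card {S. S \<subseteq> X \<and> card S \<le> D} \<le> (card X + 1) ^ D"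
proof (induction D)
  case 0
  have "{S. S \<subseteq> X \<and> card S \<le> 0} = {{}}" using assms finite_subset by fastforce
  then show ?case by simp
next
  case (Suc D)
  let ?Y = "insert None (Some ` X)" and ?N = "\<lambda>D. {S. S \<subseteq> X \<and> card S \<le> D}"
  let ?\<phi> = "\<lambda>(z, S). case z of None \<Rightarrow> S | Some x \<Rightarrow> insert x S"
  have "?N (Suc D) \<subseteq> ?\<phi> ` (?Y \<times> ?N D)"
  proof
    fix S assume S: "S \<in> ?N (Suc D)"
    show "S \<in> ?\<phi> ` (?Y \<times> ?N D)"
    proof (cases "S = {}")
      case True then show ?thesis by (intro image_eqI[of _ _ "(None, {})"]) auto
    next
      case False
      then obtain x where x: "x \<in> S" by blast
      have "finite S" using S assms finite_subset by blast
      then have "card (S - {x}) \<le> D" using S x card_Suc_Diff1[of S x] by simp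
      then show ?thesis using S x by (intro image_eqI[of _ _ "(Some x, S - {x})"]) auto
    qed
  qed
  moreover have fin: "finite (?Y \<times> ?N D)" using assms by simp
  ultimately have "card (?N (Suc D)) \<le> card (?Y \<times> ?N D)" by (rule surj_card_le[rotated])
  also have "\<dots> = (card X + 1) * card (?N D)"
    using assms by (simp add: card_cartesian_product card_image)
  also have "\<dots> \<le> (card X + 1) * (card X + 1) ^ D" by (rule mult_left_mono[OF Suc]) simp
  finally show ?case by simp
qed

lemma card_le_if_shattered_small:
  assumes "finite X" "\<F> \<subseteq> Pow X" "\<And>S. S \<subseteq> X \<Longrightarrow> shattered \<F> S \<Longrightarrow> card S \<le> D"
  shows "card \<F> \<le> (card X + 1) ^ D"
proof -
  have "card {S. S \<subseteq> X \<and> shattered \<F> S} \<le> card {S. S \<subseteq> X \<and> card S \<le> D}"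
    using assms by (intro card_mono) auto
  then show ?thesis
    using card_le_shattered[OF assms(1,2)] card_small_subsets_le[OF assms(1), of D] by linarith
qed

section \<open>Itineraries relative to a gap\<close>

definition visits :: "(real \<Rightarrow> real) \<Rightarrow> nat set \<Rightarrow> real set \<Rightarrow> real \<Rightarrow> nat set" where
  "visits f T V x = {t\<in>T. (f ^^ t) x \<in> V}"

text \<open>The pair of sets codes a word in three letters: in the gap, at or above
  \<open>d\<close>, and, at the remaining times of \<open>T\<close>, at or below
  \<open>c\<close>.\<close>

definition itineraries :: "(real \<Rightarrow> real) \<Rightarrow> real \<Rightarrow> real \<Rightarrow> nat set \<Rightarrow> (nat set \<times> nat set) set" where
  "itineraries f c d T = (\<lambda>x. (visits f T {c<..<d} x, visits f T {d..} x)) ` II"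

text \<open>When the gap visits are prescribed, a shattered set avoids them, so its times separate
  into \<open>{..c}\<close> and \<open>{d..}\<close> freely: it is an independence set, and the
  Sauer--Shelah bound applies.\<close>

lemma card_visits_fixed_gap_le:
  assumes D: "\<And>S. indep f {..c} {d..} S \<Longrightarrow> card S \<le> D" and T: "finite T"
  shows "card (visits f T {d..} ` {x\<in>II. visits f T {c<..<d} x = E}) \<le> (card T + 1) ^ D"
proof (rule card_le_if_shattered_small[OF T])
  let ?F = "visits f T {d..} ` {x\<in>II. visits f T {c<..<d} x = E}"
  show "?F \<subseteq> Pow T" by (auto simp: visits_def)
  fix S assume S: "S \<subseteq> T" "shattered ?F S"
  have real: "\<exists>x\<in>II. visits f T {c<..<d} x = E \<and> visits f T {d..} x \<inter> S = \<sigma>" if "\<sigma> \<subseteq> S" for \<sigma>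
    using S(2) that unfolding shattered_def by blast
  \<comment> \<open>The full pattern puts all times of \<open>S\<close> at or above
    \<open>d\<close>, hence outside the gap.\<close>
  have SE: "s \<notin> E" if "s \<in> S" for s
    using real[of S] that by (force simp: visits_def)
  have "indep f {..c} {d..} S"
    unfolding indep_def
  proof (intro conjI allI impI)
    show "finite S" using S(1) T finite_subset by blast
    fix \<sigma> assume \<sigma>: "\<sigma> \<subseteq> S"
    then obtain x where x: "x \<in> II" "visits f T {c<..<d} x = E" "visits f T {d..} x \<inter> S = \<sigma>"
      using real by blast
    have "(f ^^ s) x \<in> {d..}" if "s \<in> \<sigma>" for s using x(3) that by (auto simp: visits_def)
    moreover have "(f ^^ s) x \<in> {..c}" if s: "s \<in> S - \<sigma>" for s
    proof -
      have "s \<in> T" "s \<notin> visits f T {c<..<d} x" "s \<notin> visits f T {d..} x"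
        using s S(1) SE x by auto
      then show ?thesis by (auto simp: visits_def)
    qed
    ultimately show "\<exists>x\<in>II. (\<forall>s\<in>\<sigma>. (f ^^ s) x \<in> {d..}) \<and> (\<forall>s\<in>S - \<sigma>. (f ^^ s) x \<in> {..c})"
      using x(1) by blast
  qed
  then show "card S \<le> D" by (rule D)
qed

text \<open>The factor of exponent \<open>K\<close> counts the possible sets of gap visits, the one
  of exponent \<open>D\<close> the upper visits for each of them.\<close>

lemma card_itineraries_bounded_visits:
  assumes D: "\<And>S. indep f {..c} {d..} S \<Longrightarrow> card S \<le> D" and T: "finite T"
    and K: "\<And>x S. x \<in> II \<Longrightarrow> finite S \<Longrightarrow> \<forall>t\<in>S. (f ^^ t) x \<in> {c<..<d} \<Longrightarrow> card S \<le> K"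
  shows "card (itineraries f c d T) \<le> (card T + 1) ^ (K + D)"
proof -
  let ?\<E> = "{E. E \<subseteq> T \<and> card E \<le> K}"
  let ?R = "\<lambda>E. visits f T {d..} ` {x\<in>II. visits f T {c<..<d} x = E}"
  have finR: "finite (?R E)" for E
    by (rule finite_subset[of _ "Pow T"]) (use T in \<open>auto simp: visits_def\<close>)
  have fin\<E>: "finite ?\<E>" using T by simp
  have "card (visits f T {c<..<d} x) \<le> K" if "x \<in> II" for x
    using K[OF that, of "visits f T {c<..<d} x"] T by (simp add: visits_def)
  then have "itineraries f c d T \<subseteq> (SIGMA E:?\<E>. ?R E)"
    by (auto simp: itineraries_def visits_def)
  then have "card (itineraries f c d T) \<le> card (SIGMA E:?\<E>. ?R E)"
    using fin\<E> finR by (intro card_mono finite_SigmaI) auto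
  also have "\<dots> = (\<Sum>E\<in>?\<E>. card (?R E))" using fin\<E> finR by simp
  also have "\<dots> \<le> (\<Sum>E\<in>?\<E>. (card T + 1) ^ D)"
    by (intro sum_mono card_visits_fixed_gap_le[OF D T])
  also have "\<dots> = card ?\<E> * (card T + 1) ^ D" by simp
  also have "\<dots> \<le> (card T + 1) ^ K * (card T + 1) ^ D"
    by (intro mult_right_mono card_small_subsets_le[OF T]) simp
  finally show ?thesis by (simp add: power_add)
qed

text \<open>After its first visit to the gap an orbit is \<open>k\<close>-periodic, so that the rest of the itinerary
  takes at most \<open>4 ^ k\<close> values.\<close>

lemma card_itineraries_periodic_gap:
  assumes D: "\<And>S. indep f {..c} {d..} S \<Longrightarrow> card S \<le> D" and T: "finite T"
    and k: "k \<ge> 1" "\<And>x. x \<in> {c<..<d} \<Longrightarrow> (f ^^ k) x = x"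
  shows "card (itineraries f c d T) \<le> 4 ^ k * (card T + 1) ^ Suc D"
proof -
  let ?V = "\<lambda>T. visits f T {c<..<d}" and ?B = "\<lambda>T. visits f T {d..}"
  let ?n = "card T + 1"
  define R where "R T = ?B T ` {x\<in>II. ?V T x = {}}" for T
  \<comment> \<open>Reassembles an itinerary from its part \<open>r\<close> before the first gap
    visit \<open>t0\<close> and the residues modulo \<open>k\<close> at which the later orbit is in
    the gap (\<open>e\<close>) or above it (\<open>b\<close>).\<close>
  define \<Phi> where "\<Phi> t0 = (\<lambda>(r, e, b). ({t\<in>T. t0 \<le> t \<and> (t - t0) mod k \<in> e},
    r \<union> {t\<in>T. t0 \<le> t \<and> (t - t0) mod k \<in> b}))" for t0
  define X where "X t0 = R (T \<inter> {..<t0}) \<times> Pow {..<k} \<times> Pow {..<k}" for t0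
  have cardR: "card (R (T \<inter> Z)) \<le> ?n ^ D" for Z
  proof -
    have "card (R (T \<inter> Z)) \<le> (card (T \<inter> Z) + 1) ^ D"
      unfolding R_def using T by (intro card_visits_fixed_gap_le[OF D]) auto
    also have "\<dots> \<le> ?n ^ D" using T by (intro power_mono) (auto intro: card_mono)
    finally show ?thesis .
  qed
  have finR: "finite (R (T \<inter> Z))" for Z
    by (rule finite_subset[of _ "Pow T"]) (use T in \<open>auto simp: R_def visits_def\<close>)
  have finX: "finite (X t0)" for t0 by (simp add: X_def finR)
  have X4: "card (X t0) = card (R (T \<inter> {..<t0})) * 4 ^ k" for t0
    by (simp add: X_def card_cartesian_product card_Pow flip: power_mult_distrib)
  have cardX: "card (\<Phi> t0 ` X t0) \<le> ?n ^ D * 4 ^ k" for t0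
    by (rule order_trans[OF card_image_le[OF finX]]) (unfold X4, intro mult_right_mono cardR, simp)
  \<comment> \<open>Either the orbit never meets the gap at a time of \<open>T\<close>, or it first
    does so at some \<open>t0\<close>. The trivial intersection with \<open>UNIV\<close> lets
    \<open>cardR\<close> cover the former case too.\<close>
  have "itineraries f c d T \<subseteq> Pair ({}::nat set) ` R (T \<inter> UNIV) \<union> (\<Union>t0\<in>T. \<Phi> t0 ` X t0)"
  proof
    fix w assume "w \<in> itineraries f c d T"
    then obtain x where x: "x \<in> II" "w = (?V T x, ?B T x)" by (auto simp: itineraries_def)
    show "w \<in> Pair ({}::nat set) ` R (T \<inter> UNIV) \<union> (\<Union>t0\<in>T. \<Phi> t0 ` X t0)"
    proof (cases "?V T x = {}")
      case True
      then show ?thesis using x by (auto simp: R_def)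
    next
      case False
      define t0 where "t0 = Min (?V T x)"
      have finV: "finite (?V T x)" using T by (simp add: visits_def)
      have t0: "t0 \<in> T" "(f ^^ t0) x \<in> {c<..<d}"
        using Min_in[OF finV False] by (auto simp: t0_def visits_def)
      have first: "t0 \<le> t" if "t \<in> T" "(f ^^ t) x \<in> {c<..<d}" for t
        using that finV by (auto simp: t0_def visits_def)
      define y where "y = (f ^^ t0) x"
      have y: "(f ^^ t) x = (f ^^ ((t - t0) mod k)) y" if "t0 \<le> t" for t
        using that funpow_mod_eq[OF k(2)[OF t0(2)], of "t - t0"]
        by (simp add: y_def flip: funpow_add_apply)
      let ?e = "visits f {..<k} {c<..<d} y" and ?b = "visits f {..<k} {d..} y"
      have mod: "(t - t0) mod k < k" for t using k(1) by simp
      have "?V (T \<inter> {..<t0}) x = {}" using first by (force simp: visits_def)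
      then have "(?B (T \<inter> {..<t0}) x, ?e, ?b) \<in> X t0"
        using x(1) by (auto simp: X_def R_def visits_def)
      moreover have "w = \<Phi> t0 (?B (T \<inter> {..<t0}) x, ?e, ?b)"
      proof -
        have "?V T x = {t\<in>T. t0 \<le> t \<and> (t - t0) mod k \<in> ?e}"
        proof (intro equalityI subsetI)
          fix t assume "t \<in> ?V T x"
          then have t: "t \<in> T" "(f ^^ t) x \<in> {c<..<d}" by (simp_all add: visits_def)
          then show "t \<in> {t\<in>T. t0 \<le> t \<and> (t - t0) mod k \<in> ?e}"
            using first[OF t] mod y[OF first[OF t]] by (simp add: visits_def)
        qed (simp add: visits_def y)
        moreover have "?B T x = ?B (T \<inter> {..<t0}) x \<union> {t\<in>T. t0 \<le> t \<and> (t - t0) mod k \<in> ?b}"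
        proof (intro equalityI subsetI)
          fix t assume "t \<in> ?B T x"
          then show "t \<in> ?B (T \<inter> {..<t0}) x \<union> {t\<in>T. t0 \<le> t \<and> (t - t0) mod k \<in> ?b}"
            using mod y[of t] by (cases "t0 \<le> t") (simp_all add: visits_def)
        next
          fix t assume "t \<in> ?B (T \<inter> {..<t0}) x \<union> {t\<in>T. t0 \<le> t \<and> (t - t0) mod k \<in> ?b}"
          then show "t \<in> ?B T x" using y[of t] by (auto simp: visits_def)
        qed
        ultimately show ?thesis by (simp add: x(2) \<Phi>_def)
      qed
      ultimately show ?thesis using t0(1) by blast
    qed
  qed
  then have "card (itineraries f c d T) \<le> card (Pair ({}::nat set) ` R (T \<inter> UNIV) \<union> (\<Union>t0\<in>T. \<Phi> t0 ` X t0))"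
    using T finX by (intro card_mono finite_UnI finite_UN_I finite_imageI finR)
  also have "\<dots> \<le> card (Pair ({}::nat set) ` R (T \<inter> UNIV)) + card (\<Union>t0\<in>T. \<Phi> t0 ` X t0)" by (rule card_Un_le)
  also have "card (Pair ({}::nat set) ` R (T \<inter> UNIV)) \<le> ?n ^ D * 4 ^ k"
  proof -
    have "card (Pair ({}::nat set) ` R (T \<inter> UNIV)) \<le> ?n ^ D * 1"
      unfolding mult_1_right by (rule order_trans[OF card_image_le[OF finR] cardR])
    also have "\<dots> \<le> ?n ^ D * 4 ^ k" by (intro mult_left_mono) simp_all
    finally show ?thesis .
  qed
  also have "card (\<Union>t0\<in>T. \<Phi> t0 ` X t0) \<le> (\<Sum>t0\<in>T. card (\<Phi> t0 ` X t0))" by (rule card_UN_le[OF T])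
  also have "\<dots> \<le> card T * (?n ^ D * 4 ^ k)" 
    using sum_bounded_above[where A = T, OF cardX] by (simp only: of_nat_id)
  finally show ?thesis by (simp add: algebra_simps)
qed

lemma polynomial_gap:
  assumes f: "self_map_I f" and null: "null_map f" and ab: "0 \<le> a" "a < b" "b \<le> 1"
  shows "\<exists>c d C q. a \<le> c \<and> c < d \<and> d \<le> b \<and>
    (\<forall>T. finite T \<longrightarrow> card (itineraries f c d T) \<le> C * (card T + 1) ^ q)"
proof -
  obtain c d where cd: "a \<le> c" "c < d" "d \<le> b"
    and tame: "(\<exists>K. \<forall>x\<in>II. \<forall>S. finite S \<and> (\<forall>t\<in>S. (f ^^ t) x \<in> {c<..<d}) \<longrightarrow> card S \<le> K) \<or>
     (\<exists>k\<ge>1. \<forall>x\<in>{c<..<d}. (f ^^ k) x = x)"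
    using tame_subinterval[OF f null ab] by blast
  have "{..c} \<inter> {d..} = {}" using cd(2) by auto
  then obtain D where D: "\<And>S. indep f {..c} {d..} S \<Longrightarrow> card S \<le> D"
    using null_map_bounded_indep[OF f null closed_atMost closed_atLeast] by blast
  from tame have "\<exists>C q. \<forall>T. finite T \<longrightarrow> card (itineraries f c d T) \<le> C * (card T + 1) ^ q"
  proof
    assume "\<exists>K. \<forall>x\<in>II. \<forall>S. finite S \<and> (\<forall>t\<in>S. (f ^^ t) x \<in> {c<..<d}) \<longrightarrow> card S \<le> K"
    then obtain K where "\<And>x S. x \<in> II \<Longrightarrow> finite S \<Longrightarrow> \<forall>t\<in>S. (f ^^ t) x \<in> {c<..<d} \<Longrightarrow> card S \<le> K"
      by blast
    from card_itineraries_bounded_visits[OF D _ this]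
    show ?thesis by (intro exI[of _ 1] exI[of _ "K + D"]) simp
  next
    assume "\<exists>k\<ge>1. \<forall>x\<in>{c<..<d}. (f ^^ k) x = x"
    then show ?thesis using card_itineraries_periodic_gap[OF D] by blast
  qed
  then show ?thesis using cd by blast
qed

section \<open>From finitely many gaps to the given cover\<close>

lemma gap_separates:
  fixes p q :: real
  assumes m: "m \<ge> 1" and pq: "0 \<le> p" "q \<le> 1" "2 / real m < q - p"
    and cd: "\<And>j. j < m \<Longrightarrow> real j / real m \<le> c j \<and> c j < d j \<and> d j \<le> real (Suc j) / real m"
  shows "\<exists>j<m. p < d j \<and> d j \<le> q"
proof -
  \<comment> \<open>The first mesh point at or above \<open>p\<close>. As \<open>q - p\<close>
    exceeds two mesh widths, the whole mesh interval that starts there lies between \<open>p\<close>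
    and \<open>q\<close>, together with its gap.\<close>
  define j where "j = nat \<lceil>p * real m\<rceil>"
  have m0: "real m > 0" using m by simp
  have "0 \<le> p * real m" using pq m0 by simp
  then have j: "p * real m \<le> real j" "real j < p * real m + 1"
    unfolding j_def by linarith+
  have "2 < (q - p) * real m" using pq(3) m0 by (simp add: divide_less_eq)
  then have jq: "real (Suc j) < q * real m" using j by (simp add: algebra_simps)
  also have "\<dots> \<le> real m" using pq(2) m0 by (simp add: mult_left_le_one_le mult_le_cancel_right1)
  finally have jm: "j < m" by simp
  have "p \<le> real j / real m" using j(1) m0 by (simp add: le_divide_eq)
  moreover have "real (Suc j) / real m < q" using jq m0 by (simp add: divide_less_eq)
  ultimately have "p < d j \<and> d j \<le> q" using cd[OF jm] by linarith
  then show ?thesis using jm by blast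
qed

lemma open_cover_Lebesgue_number:
  assumes "open_cover \<U>"
  obtains \<delta> where "\<delta> > 0" "\<And>Y. Y \<subseteq> II \<Longrightarrow> diameter Y < \<delta> \<Longrightarrow> \<exists>U\<in>\<U>. Y \<subseteq> U"
proof -
  have "\<forall>U. \<exists>W. U \<in> \<U> \<longrightarrow> open W \<and> U = II \<inter> W"
    using assms unfolding open_cover_def openin_open by blast
  then obtain W where W: "\<And>U. U \<in> \<U> \<Longrightarrow> open (W U)" "\<And>U. U \<in> \<U> \<Longrightarrow> U = II \<inter> W U" by metis
  have "II \<subseteq> \<Union>\<U>" using assms by (simp add: open_cover_def)
  then have cov: "II \<subseteq> \<Union>(W ` \<U>)" using W(2) by blast
  have ne: "W ` \<U> \<noteq> {}" using \<open>II \<subseteq> \<Union>\<U>\<close> by (auto simp: II_def)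
  have "compact II" by (simp add: II_def)
  then obtain \<delta> where \<delta>: "0 < \<delta>" "\<And>T. T \<subseteq> II \<Longrightarrow> diameter T < \<delta> \<Longrightarrow> \<exists>B\<in>W ` \<U>. T \<subseteq> B"
    using Lebesgue_number_lemma[OF _ ne cov] W(1) by blast
  show thesis
  proof (rule that[OF \<delta>(1)])
    fix Y assume Y: "Y \<subseteq> II" "diameter Y < \<delta>"
    then obtain U where "U \<in> \<U>" "Y \<subseteq> W U" using \<delta>(2) by blast
    then show "\<exists>U\<in>\<U>. Y \<subseteq> U" using W(2) Y(1) by blast
  qed
qed

text \<open>The key of a point collects its itineraries relative to one gap in each of
  \<open>m\<close> mesh intervals. Equal keys keep orbits within \<open>2 / real m\<close> at all
  times of \<open>T\<close>, and the number of keys is at most a product of \<open>m\<close>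
  polynomial bounds.\<close>

lemma polynomial_Ncov:
  assumes f: "self_map_I f" and null: "null_map f" and \<U>: "open_cover \<U>"
  shows "\<exists>C q. \<forall>n t. strict_mono_on {..<n} t \<longrightarrow> Ncov (join_cover f t n \<U>) \<le> C * (n + 1) ^ q"
proof -
  obtain \<delta> where \<delta>: "\<delta> > 0" "\<And>Y. Y \<subseteq> II \<Longrightarrow> diameter Y < \<delta> \<Longrightarrow> \<exists>U\<in>\<U>. Y \<subseteq> U"
    using open_cover_Lebesgue_number[OF \<U>] by blast
  \<comment> \<open>The gaps resolve distances above \<open>2 / real m\<close>, which must fall
    below the Lebesgue number.\<close>
  obtain m where m: "2 / \<delta> < real m" using reals_Archimedean2 by blast
  have m1: "m \<ge> 1" using m \<delta>(1) by (cases m) (auto simp: divide_less_0_iff not_less)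
  have m\<delta>: "2 / real m < \<delta>" using m m1 \<delta>(1) by (simp add: field_simps)
  have "\<exists>c d C q. real j / real m \<le> c \<and> c < d \<and> d \<le> real (Suc j) / real m \<and>
      (\<forall>T. finite T \<longrightarrow> card (itineraries f c d T) \<le> C * (card T + 1) ^ q)" if "j < m" for j
    using that by (intro polynomial_gap[OF f null]) (simp_all add: divide_strict_right_mono)
  then obtain c d C q where cd: "\<And>j. j < m \<Longrightarrow> real j / real m \<le> c j \<and> c j < d j \<and> d j \<le> real (Suc j) / real m"
    and count: "\<And>j T. j < m \<Longrightarrow> finite T \<Longrightarrow> card (itineraries f (c j) (d j) T) \<le> C j * (card T + 1) ^ q j"
    by metis
  have "Ncov (join_cover f t n \<U>) \<le> (\<Prod>j<m. C j) * (n + 1) ^ (\<Sum>j<m. q j)"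
    if t: "strict_mono_on {..<n} t" for n t
  proof -
    define T where "T = t ` {..<n}"
    have T: "finite T" "card T = n"
      using t by (simp_all add: T_def card_image strict_mono_on_imp_inj_on)
    define key where "key x = (\<lambda>j\<in>{..<m}. (visits f T {c j<..<d j} x, visits f T {d j..} x))" for x
    have sub: "key ` II \<subseteq> PiE {..<m} (\<lambda>j. itineraries f (c j) (d j) T)"
      unfolding key_def itineraries_def by (intro image_subsetI restrict_PiE_iff[THEN iffD2]) auto
    have "finite (itineraries f (c j) (d j) T)" for j
      by (rule finite_subset[of _ "Pow T \<times> Pow T"]) (use T in \<open>auto simp: itineraries_def visits_def\<close>)
    then have fin: "finite (PiE {..<m} (\<lambda>j. itineraries f (c j) (d j) T))" by (intro finite_PiE) auto
    have close: "\<bar>(f ^^ s) x - (f ^^ s) y\<bar> \<le> 2 / real m"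
      if "x \<in> II" "y \<in> II" "key x = key y" "s \<in> T" for x y s
    proof -
      have le: "(f ^^ s) y - (f ^^ s) x \<le> 2 / real m"
        if xy: "x \<in> II" "y \<in> II" "key x = key y" for x y
      proof (rule ccontr)
        assume "\<not> ?thesis"
        then obtain j where j: "j < m" "(f ^^ s) x < d j" "d j \<le> (f ^^ s) y"
          using gap_separates[OF m1 _ _ _ cd, of "(f ^^ s) x" "(f ^^ s) y"]
            funpow_in_II[OF f xy(1), of s] funpow_in_II[OF f xy(2), of s] by (auto simp: II_def)
        have "visits f T {d j..} x = visits f T {d j..} y"
          using fun_cong[OF xy(3), of j] j(1) by (simp add: key_def)
        moreover have "s \<in> visits f T {d j..} y" "s \<notin> visits f T {d j..} x"
          using j \<open>s \<in> T\<close> by (simp_all add: visits_def)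
        ultimately show False by simp
      qed
      show ?thesis using le[of x y] le[of y x] that by auto
    qed
    have "\<exists>U\<in>\<U>. \<forall>x\<in>II. key x = \<kappa> \<longrightarrow> (f ^^ t i) x \<in> U" if i: "i < n" for \<kappa> i
    proof -
      let ?Y = "(f ^^ t i) ` {x\<in>II. key x = \<kappa>}"
      have "diameter ?Y \<le> 2 / real m"
        using close i by (intro diameter_le) (auto simp: T_def)
      moreover have "?Y \<subseteq> II" using funpow_in_II[OF f] by blast
      ultimately obtain U where "U \<in> \<U>" "?Y \<subseteq> U" using \<delta>(2)[of ?Y] m\<delta> by auto
      then show ?thesis by (intro bexI[of _ U]) auto
    qed
    then obtain \<V> where V: "\<V> \<subseteq> join_cover f t n \<U>" "finite \<V>" "II \<subseteq> \<Union>\<V>" "card \<V> \<le> card (key ` II)"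
      by (rule join_cover_by_keys[OF finite_subset[OF sub fin]])
    have "Ncov (join_cover f t n \<U>) \<le> card (key ` II)" using Ncov_le[OF V(1-3)] V(4) by simp
    also have "\<dots> \<le> card (PiE {..<m} (\<lambda>j. itineraries f (c j) (d j) T))" by (rule card_mono[OF fin sub])
    also have "\<dots> = (\<Prod>j<m. card (itineraries f (c j) (d j) T))" by (simp add: card_PiE)
    also have "\<dots> \<le> (\<Prod>j<m. C j * (n + 1) ^ q j)"
      using count[OF _ T(1)] T(2) by (intro prod_mono) auto
    also have "\<dots> = (\<Prod>j<m. C j) * (n + 1) ^ (\<Sum>j<m. q j)" by (simp add: prod.distrib power_sum)
    finally show ?thesis .
  qed
  then show ?thesis by blast
qed

theorem mainTheorem19:
  fixes f :: "real \<Rightarrow> real"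
  assumes "self_map_I f" and "null_map f"
  shows "\<forall>\<U>. open_cover \<U> \<longrightarrow>
           (\<exists>C::real. C > 0 \<and> (\<exists>q::nat. \<forall>n\<ge>1. real (pstar f \<U> n) \<le> C * real n ^ q))"
proof (intro allI impI)
  fix \<U> assume "open_cover \<U>"
  then obtain C q where Cq: "\<And>n t. strict_mono_on {..<n} t \<Longrightarrow> Ncov (join_cover f t n \<U>) \<le> C * (n + 1) ^ q"
    using polynomial_Ncov[OF assms] by blast
  have "real (pstar f \<U> n) \<le> (real C + 1) * 2 ^ q * real n ^ q" if n: "n \<ge> 1" for n
  proof -
    \<comment> \<open>The supremum in \<open>pstar\<close> is bounded by \<open>cSup_least\<close>,
      which requires at least one admissible sequence.\<close>
    have "strict_mono_on {..<n} (\<lambda>i::nat. i)" by (simp add: strict_mono_on_def)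
    then have "pstar f \<U> n \<le> C * (n + 1) ^ q"
      unfolding pstar_def using Cq by (intro cSup_least) auto
    \<comment> \<open>Here \<open>n + 1\<close> is at most \<open>2 * n\<close> because
      \<open>n\<close> is positive; replacing \<open>C\<close> by \<open>C + 1\<close> makes the
      constant positive.\<close>
    also have "\<dots> \<le> (C + 1) * (2 * n) ^ q" using n by (intro mult_mono power_mono) auto
    finally have "real (pstar f \<U> n) \<le> real ((C + 1) * (2 * n) ^ q)" by (rule of_nat_mono)
    then show ?thesis by (simp add: power_mult_distrib algebra_simps)
  qed
  then show "\<exists>C::real. C > 0 \<and> (\<exists>q::nat. \<forall>n\<ge>1. real (pstar f \<U> n) \<le> C * real n ^ q)"
    by (intro exI[of _ "(real C + 1) * 2 ^ q"]) (auto intro: exI[of _ q])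
qed

end
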